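(* Let $\sigma$ be a complex polynomial of degree $\le2$, $\sigma\ne0$, and $\kappa$ a complex polynomial of degree $\le1$. 1. Suppose that $\omega\in\mathbb{C}$ and a polynomial $P$ of degree $n$ solves $$\big(\mathcal{H}(\sigma,\kappa)+\omega\big)P(z)=0. \qquad( * )$$ Then $n(n+1)\frac{\sigma''}{2}+(n+\frac12)\kappa'+\omega=0$. 2. Suppose that $k\frac{\sigma''}{2}+\kappa'\neq0$ for $k=2,3,\dots$. Then for any $\omega\in\mathbb{C}$ the space of polynomial solutions of $( * )$ is at most $1$-dimensional. 3. Let $\rho$ be a nonzero solution of $(\sigma(z)\partial_z-\kappa(z))\rho(z)=0$ and let $n\in\{0,1,2,\dots\}$. Define $$P_n(\sigma,\kappa;z):=\frac1{n!}\rho^{-1}(z)\partial_z^n\sigma^n(z)\rho(z)=\frac{1}{2\pi i}\rho^{-1}(z)\int_{[0^+]}\sigma^n(z+t)\rho(z+t)t^{-n-1}\,dt,$$ where $[0^+]$ denotes a counterclockwise loop around $t=0$. Then $P_n(\sigma,\kappa;z)$ is a polynomial of degree $n$ or less, and $$\Big(\mathcal{H}(\sigma,\kappa)-n(n+1)\frac{\sigma''}{2}-(n+\tfrac12)\kappa'\Big)P_n(\sigma,\kappa;z)=0 .$$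
   Context: $\mathcal{H}(\sigma,\kappa):=\sigma(z)\partial_z^2+(\sigma'(z)+\kappa(z))\partial_z+\frac12\kappa'$. In the definition of $P_n$, $\partial_z^n$ acts on the product $\sigma^n\rho$, $z$ is taken with $\sigma(z)\ne0$, and the loop is small enough that $z+t$ stays in a disc around $z$ free of zeros of $\sigma$, on which a branch of $\rho$ is fixed. The statement that $P_n$ is a polynomial means that it coincides with a polynomial there. *)

theory Defs
  imports "HOL-Complex_Analysis.Complex_Analysis" "HOL-Computational_Algebra.Polynomial"
begin

definition hyp_op :: "complex poly \<Rightarrow> complex poly \<Rightarrow> (complex \<Rightarrow> complex) \<Rightarrow> complex \<Rightarrow> complex" where
  "hyp_op \<sigma> \<kappa> f z =
     poly \<sigma> z * (deriv ^^ 2) f z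
     + (poly (pderiv \<sigma>) z + poly \<kappa> z) * deriv f z
     + poly (pderiv \<kappa>) z / 2 * f z"

definition poly_solutions :: "complex poly \<Rightarrow> complex poly \<Rightarrow> complex \<Rightarrow> complex poly set" where
  "poly_solutions \<sigma> \<kappa> \<omega> = {P. \<forall>z. hyp_op \<sigma> \<kappa> (poly P) z + \<omega> * poly P z = 0}"

text \<open>
  A branch on the region \<open>D\<close> of a nonzero solution of \<open>\<sigma> \<rho>' = \<kappa> \<rho>\<close>. Solutions are in general
  multivalued, so they are only considered on regions without zeros of \<open>\<sigma>\<close>; the values of
  \<open>\<rho>\<close> outside \<open>D\<close> are irrelevant. ``Nonzero'' means not identically zero on \<open>D\<close>.
\<close>
definition weight_on :: "complex poly \<Rightarrow> complex poly \<Rightarrow> complex set \<Rightarrow> (complex \<Rightarrow> complex) \<Rightarrow> bool" where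
  "weight_on \<sigma> \<kappa> D \<rho> \<longleftrightarrow>
     open D \<and> connected D \<and> (\<forall>z\<in>D. poly \<sigma> z \<noteq> 0) \<and>
     \<rho> holomorphic_on D \<and>
     (\<forall>z\<in>D. poly \<sigma> z * deriv \<rho> z - poly \<kappa> z * \<rho> z = 0) \<and>
     (\<exists>z\<in>D. \<rho> z \<noteq> 0)"

definition rodrigues :: "complex poly \<Rightarrow> (complex \<Rightarrow> complex) \<Rightarrow> nat \<Rightarrow> complex \<Rightarrow> complex" where
  "rodrigues \<sigma> \<rho> n z =
     1 / fact n * inverse (\<rho> z) * (deriv ^^ n) (\<lambda>w. poly \<sigma> w ^ n * \<rho> w) z"

text \<open>Counterclockwise loops around \<open>0\<close> in \<open>U\<close>: the orientation is encoded by winding number \<open>1\<close>; simplicity is not required.\<close>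
definition ccw_loop_in :: "complex set \<Rightarrow> (real \<Rightarrow> complex) \<Rightarrow> bool" where
  "ccw_loop_in U \<gamma> \<longleftrightarrow>
     valid_path \<gamma> \<and> pathfinish \<gamma> = pathstart \<gamma> \<and>
     path_image \<gamma> \<subseteq> U - {0} \<and> winding_number \<gamma> 0 = 1"

end

theory Submission
  imports Defs
begin

text \<open>
  If \<open>\<sigma> \<rho>' = \<kappa> \<rho>\<close>, then \<open>\<partial>\<^sup>k (\<sigma>\<^sup>m \<rho>) = \<sigma>\<^bsup>m-k\<^esup> Q\<^sub>k \<rho>\<close> for polynomials given by \<open>Q\<^sub>0 = 1\<close> and
  \<open>Q\<^sub>k\<^sub>+\<^sub>1 = \<sigma> Q\<^sub>k' + ((m - k) \<sigma>' + \<kappa>) Q\<^sub>k\<close>. Since \<open>\<sigma>'''\<close> and \<open>\<kappa>''\<close> vanish, these form an Appell-like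
  family: \<open>Q\<^sub>k' = c\<^sub>k Q\<^sub>k\<^sub>-\<^sub>1\<close> with the constant \<open>c\<^sub>k = k ((m - (k-1)/2) \<sigma>'' + \<kappa>')\<close>. Substituting this
  back into the recursion gives \<open>\<sigma> Q\<^sub>k'' + ((m-k+1) \<sigma>' + \<kappa>) Q\<^sub>k' = c\<^sub>k Q\<^sub>k\<close>, which for \<open>m = k = n\<close> is the
  equation for \<open>P\<^sub>n = Q\<^sub>n / n!\<close>. For \<open>m = 0\<close> the formula shows that at a zero of \<open>\<rho>\<close> all derivatives
  of \<open>\<rho>\<close> would vanish, so \<open>\<rho>\<close> has no zeros. The first two parts compare leading coefficients.
\<close>

text \<open>The exponent \<open>m\<close> of \<sigma> stays fixed while \<open>k\<close> counts
  derivatives. The difference \<open>of_nat m - of_nat k\<close> is complex, so it does not truncate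
  for \<open>k > m\<close>, a range reached when \<open>m = 0\<close>.\<close>

fun rodrigues_poly :: "complex poly \<Rightarrow> complex poly \<Rightarrow> nat \<Rightarrow> nat \<Rightarrow> complex poly" where
  "rodrigues_poly \<sigma> \<kappa> m 0 = 1"
| "rodrigues_poly \<sigma> \<kappa> m (Suc k) = \<sigma> * pderiv (rodrigues_poly \<sigma> \<kappa> m k)
     + (smult (of_nat m - of_nat k) (pderiv \<sigma>) + \<kappa>) * rodrigues_poly \<sigma> \<kappa> m k"

section \<open>The differential equation as an identity of polynomials\<close>

lemma hyp_op_poly:
  "hyp_op \<sigma> \<kappa> (poly P) z = poly (\<sigma> * pderiv (pderiv P) + (pderiv \<sigma> + \<kappa>) * pderiv P
     + smult (1/2) (pderiv \<kappa> * P)) z"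
proof -
  have d: "deriv (poly q) = poly (pderiv q)" for q :: "complex poly"
    by (intro ext DERIV_imp_deriv poly_DERIV)
  show ?thesis
    by (simp add: hyp_op_def numeral_2_eq_2 d)
qed

lemma poly_solutions_iff:
  "P \<in> poly_solutions \<sigma> \<kappa> \<omega> \<longleftrightarrow>
     \<sigma> * pderiv (pderiv P) + (pderiv \<sigma> + \<kappa>) * pderiv P + smult (1/2) (pderiv \<kappa> * P) + smult \<omega> P = 0"
proof -
  have "P \<in> poly_solutions \<sigma> \<kappa> \<omega> \<longleftrightarrow> poly (\<sigma> * pderiv (pderiv P) + (pderiv \<sigma> + \<kappa>) * pderiv P
     + smult (1/2) (pderiv \<kappa> * P) + smult \<omega> P) = poly 0"
    by (simp add: poly_solutions_def hyp_op_poly fun_eq_iff)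
  then show ?thesis
    by (simp only: poly_eq_poly_eq_iff)
qed

section \<open>Degree and uniqueness of polynomial solutions\<close>

lemma degree_le_2_explicit:
  fixes \<sigma> :: "'a::zero poly"
  assumes "degree \<sigma> \<le> 2"
  shows "\<sigma> = [:coeff \<sigma> 0, coeff \<sigma> 1, coeff \<sigma> 2:]"
proof (rule poly_eqI)
  fix i
  show "coeff \<sigma> i = coeff [:coeff \<sigma> 0, coeff \<sigma> 1, coeff \<sigma> 2:] i"
    using assms by (auto simp: coeff_pCons numeral_2_eq_2 coeff_eq_0 split: nat.splits)
qed

lemma degree_le_1_explicit:
  fixes \<kappa> :: "'a::zero poly"
  assumes "degree \<kappa> \<le> 1"
  shows "\<kappa> = [:coeff \<kappa> 0, coeff \<kappa> 1:]"
proof (rule poly_eqI)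
  fix i
  show "coeff \<kappa> i = coeff [:coeff \<kappa> 0, coeff \<kappa> 1:] i"
    using assms by (auto simp: coeff_pCons coeff_eq_0 split: nat.splits)
qed

text \<open>Compare coefficients at \<open>n = degree P\<close>, writing c, e for the top
  coefficients of \<sigma>, \<kappa>. The terms with P'' and P' contribute n(n-1)c + 2nc + ne, and
  \<kappa>'/2 contributes e/2; the total multiplies the nonzero leading coefficient.\<close>

lemma poly_solutions_degree:
  assumes s: "degree \<sigma> \<le> 2" and k: "degree \<kappa> \<le> 1"
    and P: "P \<in> poly_solutions \<sigma> \<kappa> \<omega>" "P \<noteq> 0"
  shows "of_nat (degree P) * (of_nat (degree P) + 1) * coeff \<sigma> 2
           + (of_nat (degree P) + 1/2) * coeff \<kappa> 1 + \<omega> = 0"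
proof -
  obtain a b c where \<sigma>: "\<sigma> = [:a, b, c:]"
    using degree_le_2_explicit[OF s] by blast
  obtain d e where \<kappa>: "\<kappa> = [:d, e:]"
    using degree_le_1_explicit[OF k] by blast
  define n where "n = degree P"
  have z: "coeff P i = 0" if "i > n" for i
    using that by (simp add: n_def coeff_eq_0)
  have "coeff (\<sigma> * pderiv (pderiv P) + (pderiv \<sigma> + \<kappa>) * pderiv P
           + smult (1/2) (pderiv \<kappa> * P) + smult \<omega> P) n = 0"
    using P(1) by (simp only: poly_solutions_iff coeff_0)
  then have "(of_nat n * (of_nat n + 1) * c + (of_nat n + 1/2) * e + \<omega>) * coeff P n = 0"
    unfolding \<sigma> \<kappa>
    by (auto simp: coeff_pCons coeff_pderiv pderiv_pCons z algebra_simps split: nat.splits)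
  moreover have "coeff P n \<noteq> 0"
    using P(2) by (simp add: n_def)
  ultimately show ?thesis
    by (simp add: \<sigma> \<kappa> numeral_2_eq_2 flip: n_def)
qed

lemma pderiv2_degree_le_2:
  fixes \<sigma> :: "complex poly"
  assumes "degree \<sigma> \<le> 2"
  shows "pderiv (pderiv \<sigma>) = [:2 * coeff \<sigma> 2:]"
  by (subst degree_le_2_explicit[OF assms]) (simp add: pderiv_pCons)

lemma pderiv_degree_le_1:
  fixes \<kappa> :: "complex poly"
  assumes "degree \<kappa> \<le> 1"
  shows "pderiv \<kappa> = [:coeff \<kappa> 1:]"
  by (subst degree_le_1_explicit[OF assms]) (simp add: pderiv_pCons)

lemma poly_solutions_diff_smult:
  assumes "P \<in> poly_solutions \<sigma> \<kappa> \<omega>" "Q \<in> poly_solutions \<sigma> \<kappa> \<omega>"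
  shows "P - smult c Q \<in> poly_solutions \<sigma> \<kappa> \<omega>"
proof -
  define L where "L R = \<sigma> * pderiv (pderiv R) + (pderiv \<sigma> + \<kappa>) * pderiv R
    + smult (1/2) (pderiv \<kappa> * R) + smult \<omega> R" for R
  have "L (P - smult c Q) = L P - smult c (L Q)"
    by (simp add: L_def pderiv_diff pderiv_smult algebra_simps smult_diff_right smult_add_right)
  then show ?thesis
    using assms by (simp add: poly_solutions_iff L_def)
qed

lemma poly_solutions_degree_unique:
  assumes s: "degree \<sigma> \<le> 2" and k: "degree \<kappa> \<le> 1"
    and nz: "\<And>k::nat. 2 \<le> k \<Longrightarrow> of_nat k * coeff \<sigma> 2 + coeff \<kappa> 1 \<noteq> 0"
    and P: "P \<in> poly_solutions \<sigma> \<kappa> \<omega>" "P \<noteq> 0"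
    and Q: "Q \<in> poly_solutions \<sigma> \<kappa> \<omega>" "Q \<noteq> 0"
  shows "degree P = degree Q"
proof (rule ccontr)
  let ?n = "degree P" and ?m = "degree Q"
  assume ne: "?n \<noteq> ?m"
  \<comment> \<open>The degree condition is quadratic in the degree, so subtracting it for two
    degrees splits off their difference.\<close>
  have "(of_nat ?n - of_nat ?m) * (of_nat (?n + ?m + 1) * coeff \<sigma> 2 + coeff \<kappa> 1)
      = (of_nat ?n * (of_nat ?n + 1) * coeff \<sigma> 2 + (of_nat ?n + 1/2) * coeff \<kappa> 1 + \<omega>)
      - (of_nat ?m * (of_nat ?m + 1) * coeff \<sigma> 2 + (of_nat ?m + 1/2) * coeff \<kappa> 1 + \<omega>)"
    by (simp add: algebra_simps)
  also have "\<dots> = 0"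
    by (simp only: poly_solutions_degree[OF s k P] poly_solutions_degree[OF s k Q] diff_self)
  finally have "(of_nat ?n - of_nat ?m) * (of_nat (?n + ?m + 1) * coeff \<sigma> 2 + coeff \<kappa> 1) = 0" .
  \<comment> \<open>Distinct degrees have sum at least 1, so the index is at least 2, where
    \<open>nz\<close> starts.\<close>
  moreover have "of_nat (?n + ?m + 1) * coeff \<sigma> 2 + coeff \<kappa> 1 \<noteq> 0"
    using ne by (intro nz) linarith
  ultimately show False
    using ne by simp
qed

lemma poly_solutions_multiple:
  assumes s: "degree \<sigma> \<le> 2" and k: "degree \<kappa> \<le> 1"
    and nz: "\<And>k::nat. 2 \<le> k \<Longrightarrow> of_nat k * coeff \<sigma> 2 + coeff \<kappa> 1 \<noteq> 0"
    and P: "P \<in> poly_solutions \<sigma> \<kappa> \<omega>"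
    and Q: "Q \<in> poly_solutions \<sigma> \<kappa> \<omega>" "Q \<noteq> 0"
  shows "\<exists>c. P = smult c Q"
proof (cases "P = 0")
  case True
  then show ?thesis by (intro exI[of _ 0]) simp
next
  case False
  \<comment> \<open>With this \<open>c\<close> the leading terms of \<open>P\<close> and
    \<open>smult c Q\<close> cancel. A nonzero difference would be a solution of degree
    \<open>degree Q\<close> whose coefficient in that degree is zero.\<close>
  define c where "c = lead_coeff P / lead_coeff Q"
  have deg: "degree P = degree Q"
    using poly_solutions_degree_unique[OF s k nz P False Q] .
  have "P - smult c Q = 0"
  proof (rule ccontr)
    assume "P - smult c Q \<noteq> 0"
    with poly_solutions_diff_smult[OF P Q(1)]
    have "degree (P - smult c Q) = degree Q"
      using poly_solutions_degree_unique[OF s k nz _ _ Q] by blast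
    moreover have "coeff (P - smult c Q) (degree Q) = 0"
      using Q(2) by (simp add: c_def deg)
    ultimately show False
      using \<open>P - smult c Q \<noteq> 0\<close> by (metis leading_coeff_0_iff)
  qed
  then show ?thesis by auto
qed

lemma poly_solutions_dim_le_1:
  assumes s: "degree \<sigma> \<le> 2" and k: "degree \<kappa> \<le> 1"
    and nz: "\<And>k::nat. 2 \<le> k \<Longrightarrow> of_nat k * coeff \<sigma> 2 + coeff \<kappa> 1 \<noteq> 0"
  shows "\<exists>B. finite B \<and> card B \<le> 1 \<and> \<not> module.dependent smult B
           \<and> module.span smult B = poly_solutions \<sigma> \<kappa> \<omega>"
proof -
  interpret poly_module: module "smult :: complex \<Rightarrow> complex poly \<Rightarrow> complex poly"
    by standard (simp_all add: smult_add_left smult_add_right)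
  have 0: "0 \<in> poly_solutions \<sigma> \<kappa> \<omega>"
    by (simp add: poly_solutions_iff)
  show ?thesis
  proof (cases "poly_solutions \<sigma> \<kappa> \<omega> = {0}")
    case True
    then show ?thesis
      by (intro exI[of _ "{}"]) (simp add: poly_module.independent_empty)
  next
    case False
    then obtain Q where Q: "Q \<in> poly_solutions \<sigma> \<kappa> \<omega>" "Q \<noteq> 0"
      using 0 by blast
    have "smult c Q \<in> poly_solutions \<sigma> \<kappa> \<omega>" for c
      using poly_solutions_diff_smult[OF 0 Q(1), of "- c"] by simp
    then have "module.span smult {Q} = poly_solutions \<sigma> \<kappa> \<omega>"
      using poly_solutions_multiple[OF s k nz _ Q]
      by (fastforce simp: poly_module.span_singleton image_iff)
    moreover have "\<not> module.dependent smult {Q}"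
      using Q(2) by (auto simp: poly_module.dependent_finite)
    ultimately show ?thesis
      by (intro exI[of _ "{Q}"]) simp
  qed
qed

section \<open>Degree and differential equation of the Rodrigues polynomials\<close>

lemma degree_rodrigues_poly:
  assumes s: "degree \<sigma> \<le> 2" and k: "degree \<kappa> \<le> 1"
  shows "degree (rodrigues_poly \<sigma> \<kappa> m j) \<le> j"
proof (induction j)
  case 0
  then show ?case by simp
next
  case (Suc j)
  let ?Q = "rodrigues_poly \<sigma> \<kappa> m j"
  have "degree (\<sigma> * pderiv ?Q) \<le> Suc j"
  \<comment> \<open>For constant \<open>?Q\<close> the truncated \<open>degree ?Q - 1\<close> does
    not drop, so the product bound could give 2 when \<open>j = 0\<close>; but then the product
    itself is zero.\<close>
  proof (cases "pderiv ?Q = 0")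
    case False
    then have "degree ?Q \<noteq> 0"
      by (simp add: pderiv_eq_0_iff)
    then show ?thesis
      using degree_mult_le[of \<sigma> "pderiv ?Q"] degree_pderiv[of ?Q] s Suc.IH by linarith
  qed simp
  moreover have "degree (smult (of_nat m - of_nat j) (pderiv \<sigma>) + \<kappa>) \<le> 1"
    using s k degree_smult_le[of "of_nat m - of_nat j" "pderiv \<sigma>"]
    by (intro degree_add_le) (auto simp: degree_pderiv)
  then have "degree ((smult (of_nat m - of_nat j) (pderiv \<sigma>) + \<kappa>) * ?Q) \<le> Suc j"
    using degree_mult_le[of "smult (of_nat m - of_nat j) (pderiv \<sigma>) + \<kappa>" ?Q] Suc.IH by linarith
  ultimately show ?case
    by (auto intro: degree_add_le)
qed

lemma pderiv_rodrigues_poly: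
  assumes s: "pderiv (pderiv \<sigma>) = [:2 * s2:]" and k: "pderiv \<kappa> = [:k1:]"
  shows "pderiv (rodrigues_poly \<sigma> \<kappa> m (Suc j)) =
    smult (of_nat (Suc j) * ((2 * of_nat m - of_nat j) * s2 + k1)) (rodrigues_poly \<sigma> \<kappa> m j)"
proof (induction j)
  case 0
  then show ?case
    by (simp add: pderiv_add pderiv_mult pderiv_smult s k)
next
  case (Suc j)
  let ?Q = "rodrigues_poly \<sigma> \<kappa> m" and ?c = "of_nat (Suc j) * ((2 * of_nat m - of_nat j) * s2 + k1)"
  have Q': "pderiv (?Q (Suc j)) = smult ?c (?Q j)"
    by (fact Suc.IH)
  \<comment> \<open>The term \<sigma>' Q' from the product rule raises the factor m - (j+1) of
    \<sigma>' to m - j, which is the factor in the recursion for \<open>?Q (Suc j)\<close>.\<close>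
  have "pderiv (?Q (Suc (Suc j))) = \<sigma> * pderiv (pderiv (?Q (Suc j)))
      + (smult (of_nat m - of_nat j) (pderiv \<sigma>) + \<kappa>) * pderiv (?Q (Suc j))
      + smult ((of_nat m - of_nat (Suc j)) * (2 * s2) + k1) (?Q (Suc j))"
    unfolding rodrigues_poly.simps(2)[of _ _ _ "Suc j"] pderiv_add pderiv_mult pderiv_smult s k
    by (simp add: algebra_simps smult_add_left smult_diff_left del: rodrigues_poly.simps)
  \<comment> \<open>By the induction hypothesis this is \<open>?c\<close> times the recursion that
    produces \<open>?Q (Suc j)\<close>.\<close>
  also have "\<sigma> * pderiv (pderiv (?Q (Suc j)))
      + (smult (of_nat m - of_nat j) (pderiv \<sigma>) + \<kappa>) * pderiv (?Q (Suc j)) = smult ?c (?Q (Suc j))"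
    unfolding Q' by (simp add: pderiv_smult smult_add_right)
  also have "\<dots> + smult ((of_nat m - of_nat (Suc j)) * (2 * s2) + k1) (?Q (Suc j))
      = smult (?c + ((of_nat m - of_nat (Suc j)) * (2 * s2) + k1)) (?Q (Suc j))"
    by (simp only: smult_add_left)
  also have "?c + ((of_nat m - of_nat (Suc j)) * (2 * s2) + k1)
      = of_nat (Suc (Suc j)) * ((2 * of_nat m - of_nat (Suc j)) * s2 + k1)"
    by (simp add: algebra_simps)
  finally show ?case .
qed

lemma rodrigues_poly_ode:
  assumes s: "pderiv (pderiv \<sigma>) = [:2 * s2:]" and k: "pderiv \<kappa> = [:k1:]"
  shows "\<sigma> * pderiv (pderiv (rodrigues_poly \<sigma> \<kappa> n n))
           + (pderiv \<sigma> + \<kappa>) * pderiv (rodrigues_poly \<sigma> \<kappa> n n)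
         = smult (of_nat n * ((of_nat n + 1) * s2 + k1)) (rodrigues_poly \<sigma> \<kappa> n n)"
proof (cases n)
  case 0
  then show ?thesis by simp
next
  case (Suc j)
  have Q': "pderiv (rodrigues_poly \<sigma> \<kappa> n n) =
      smult (of_nat n * ((of_nat n + 1) * s2 + k1)) (rodrigues_poly \<sigma> \<kappa> n j)"
    using pderiv_rodrigues_poly[OF s k, of n j] by (simp add: Suc algebra_simps)
  \<comment> \<open>In the last recursion step the factor of \<sigma>' is n - j = 1, giving exactly
    the first-order coefficient of the operator.\<close>
  have Q: "rodrigues_poly \<sigma> \<kappa> n n =
      \<sigma> * pderiv (rodrigues_poly \<sigma> \<kappa> n j) + (pderiv \<sigma> + \<kappa>) * rodrigues_poly \<sigma> \<kappa> n j"
    by (simp add: Suc)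
  show ?thesis
    unfolding Q' pderiv_smult mult_smult_right smult_add_right[symmetric] Q[symmetric] ..
qed

section \<open>Derivatives of the weight and the Rodrigues formula\<close>

lemma higher_deriv_weight:
  assumes w: "weight_on \<sigma> \<kappa> D \<rho>" and z: "z \<in> D"
  shows "(deriv ^^ k) (\<lambda>w. poly \<sigma> w ^ m * \<rho> w) z
           = poly \<sigma> z ^ m / poly \<sigma> z ^ k * poly (rodrigues_poly \<sigma> \<kappa> m k) z * \<rho> z"
  using z
proof (induction k arbitrary: z)
  case 0
  then show ?case by simp
next
  case (Suc k)
  let ?Q = "rodrigues_poly \<sigma> \<kappa> m"
  have D: "open D" "\<rho> holomorphic_on D" "poly \<sigma> z \<noteq> 0"
    and ode: "poly \<sigma> z * deriv \<rho> z = poly \<kappa> z * \<rho> z"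
    using w Suc.prems by (auto simp: weight_on_def)
  have \<rho>: "(\<rho> has_field_derivative deriv \<rho> z) (at z)"
    using D Suc.prems holomorphic_derivI by blast
  \<comment> \<open>Differentiating the induction hypothesis requires it near \<open>z\<close>, not
    only at \<open>z\<close>; openness of \<open>D\<close> supplies this.\<close>
  have "\<forall>\<^sub>F x in nhds z. (deriv ^^ k) (\<lambda>w. poly \<sigma> w ^ m * \<rho> w) x
           = poly \<sigma> x ^ m / poly \<sigma> x ^ k * poly (?Q k) x * \<rho> x"
    using eventually_nhds_in_open[OF D(1) Suc.prems] by eventually_elim (rule Suc.IH)
  then have "(deriv ^^ Suc k) (\<lambda>w. poly \<sigma> w ^ m * \<rho> w) z
      = deriv (\<lambda>x. poly \<sigma> x ^ m / poly \<sigma> x ^ k * poly (?Q k) x * \<rho> x) z"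
    by (simp add: deriv_cong_ev)
  also have "\<dots> = poly \<sigma> z ^ m / poly \<sigma> z ^ Suc k * poly (?Q (Suc k)) z * \<rho> z"
  proof (rule DERIV_imp_deriv)
    let ?s = "poly \<sigma> z" and ?s' = "poly (pderiv \<sigma>) z"
    \<comment> \<open>The logarithmic form avoids the exponent \<open>j - 1\<close> and so covers
      \<open>j = 0\<close> uniformly.\<close>
    have pow: "((\<lambda>x. poly \<sigma> x ^ j) has_field_derivative of_nat j * ?s ^ j * (?s' / ?s)) (at z)" for j
      using DERIV_power[OF poly_DERIV[of \<sigma> z], of j] D(3) by (cases j) (auto simp: mult_ac)
    have quot: "((\<lambda>x. poly \<sigma> x ^ m / poly \<sigma> x ^ k) has_field_derivative
        (of_nat m - of_nat k) * (?s ^ m / ?s ^ k) * (?s' / ?s)) (at z)"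
      by (rule derivative_eq_intros pow refl | use D(3) in simp; fail)+
        (use D(3) in \<open>simp add: field_simps\<close>)
    have d: "deriv \<rho> z = poly \<kappa> z * \<rho> z / ?s"
      using ode D(3) by (simp add: field_simps)
    show "((\<lambda>x. poly \<sigma> x ^ m / poly \<sigma> x ^ k * poly (?Q k) x * \<rho> x) has_field_derivative
       ?s ^ m / ?s ^ Suc k * poly (?Q (Suc k)) z * \<rho> z) (at z)"
      by (rule DERIV_cong[OF DERIV_mult[OF DERIV_mult[OF quot poly_DERIV] \<rho>]])
        (use D(3) in \<open>simp add: d field_simps\<close>)
  qed
  finally show ?case .
qed

lemma weight_nonzero:
  assumes w: "weight_on \<sigma> \<kappa> D \<rho>" and z: "z \<in> D"
  shows "\<rho> z \<noteq> 0"
proof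
  assume "\<rho> z = 0"
  then have "(deriv ^^ k) \<rho> z = 0" for k
    using higher_deriv_weight[OF w z, of k 0] by simp
  \<comment> \<open>Identity theorem on the connected set \<open>D\<close>.\<close>
  then have "\<rho> x = 0" if "x \<in> D" for x
    using w z that by (intro holomorphic_fun_eq_0_on_connected[of \<rho> D z]) (auto simp: weight_on_def)
  then show False
    using w by (auto simp: weight_on_def)
qed

text \<open>For \<open>k = m = n\<close> the powers of \<sigma> cancel, as does \<rho> against its
  inverse.\<close>

lemma rodrigues_eq_poly:
  assumes w: "weight_on \<sigma> \<kappa> D \<rho>" and z: "z \<in> D"
  shows "rodrigues \<sigma> \<rho> n z = poly (smult (1 / fact n) (rodrigues_poly \<sigma> \<kappa> n n)) z"
  using weight_nonzero[OF w z] w z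
  by (simp add: rodrigues_def higher_deriv_weight[OF w z] weight_on_def)

section \<open>The contour integral representation\<close>

text \<open>Residue theorem with the single possible pole 0, around which the loop winds once; the
  residue is the n-th Taylor coefficient of \<open>f\<close>.\<close>

lemma contour_integral_higher_deriv:
  assumes f: "f holomorphic_on ball 0 r" and r: "0 < r" and g: "ccw_loop_in (ball 0 r) \<gamma>"
  shows "contour_integral \<gamma> (\<lambda>t. f t * t powi (- int n - 1))
           = 2 * of_real pi * \<i> * (deriv ^^ n) f 0 / fact n"
proof -
  have pow: "f t * t powi (- int n - 1) = f t / (t - 0) ^ Suc n" for t
  proof -
    have "- int n - 1 = - int (Suc n)" by simp
    then show ?thesis
      by (simp only: power_int_minus power_int_of_nat divide_inverse diff_zero)
  qed
  have hol: "(\<lambda>t. f t / (t - 0) ^ Suc n) holomorphic_on ball 0 r - {0}"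
    by (intro holomorphic_intros holomorphic_on_subset[OF f]) auto
  \<comment> \<open>The loop lies in a convex set, so it winds around no point outside it.\<close>
  have out: "\<forall>z. z \<notin> ball 0 r \<longrightarrow> winding_number \<gamma> z = 0"
    using g by (auto simp: ccw_loop_in_def valid_path_imp_path
        intro!: winding_number_zero_outside[of _ "ball 0 r"])
  have "contour_integral \<gamma> (\<lambda>t. f t / (t - 0) ^ Suc n) =
      2 * of_real pi * \<i> * (\<Sum>p\<in>{0}. winding_number \<gamma> p * residue (\<lambda>t. f t / (t - 0) ^ Suc n) p)"
    by (subst Residue_theorem[OF _ _ _ hol _ _ _ out]) (use g in \<open>auto simp: ccw_loop_in_def\<close>)
  also have "(\<Sum>p\<in>{0}. winding_number \<gamma> p * residue (\<lambda>t. f t / (t - 0) ^ Suc n) p)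
      = residue (\<lambda>t. f t / (t - 0) ^ Suc n) 0"
    using g by (simp add: ccw_loop_in_def)
  also have "residue (\<lambda>t. f t / (t - 0) ^ Suc n) 0 = (deriv ^^ n) f 0 / fact n"
    using r by (intro residue_holomorphic_over_power[of "ball 0 r"] f) auto
  finally show ?thesis
    by (simp only: pow times_divide_eq_right)
qed

text \<open>Translation by \<open>z\<close> moves the product of \<open>\<sigma> ^ n\<close> and
  \<rho> to a disc around 0, where the residue computation applies.\<close>

lemma rodrigues_contour:
  assumes w: "weight_on \<sigma> \<kappa> D \<rho>" and r: "0 < r" "ball z r \<subseteq> D" and g: "ccw_loop_in (ball 0 r) \<gamma>"
  shows "rodrigues \<sigma> \<rho> n z = 1 / (2 * of_real pi * \<i>) * inverse (\<rho> z) *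
           contour_integral \<gamma> (\<lambda>t. poly \<sigma> (z + t) ^ n * \<rho> (z + t) * t powi (- int n - 1))"
proof -
  define u where "u = (\<lambda>w. poly \<sigma> w ^ n * \<rho> w)"
  have "u holomorphic_on D"
    using w unfolding u_def by (intro holomorphic_intros) (auto simp: weight_on_def)
  then have "(u \<circ> (\<lambda>t. z + t)) holomorphic_on ball 0 r"
    using r(2) by (intro holomorphic_on_compose_gen[where t = D] holomorphic_intros)
      (auto simp: subset_iff dist_norm)
  then have "contour_integral \<gamma> (\<lambda>t. u (z + t) * t powi (- int n - 1))
      = 2 * of_real pi * \<i> * (deriv ^^ n) (\<lambda>t. u (z + t)) 0 / fact n"
    by (intro contour_integral_higher_deriv[OF _ r(1) g]) (simp add: o_def)
  also have "(deriv ^^ n) (\<lambda>t. u (z + t)) 0 = (deriv ^^ n) u z"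
    by (simp add: higher_deriv_shift_0[of n u z] o_def)
  finally show ?thesis
    unfolding u_def rodrigues_def by (simp only:) (simp add: divide_simps)
qed

theorem theorem7p3:
  fixes \<sigma> \<kappa> :: "complex poly"
  assumes "degree \<sigma> \<le> 2" and "\<sigma> \<noteq> 0" and "degree \<kappa> \<le> 1"
  shows
    "(\<forall>\<omega> n P. P \<in> poly_solutions \<sigma> \<kappa> \<omega> \<and> P \<noteq> 0 \<and> degree P = n \<longrightarrow>
        smult (of_nat n * (of_nat n + 1) / 2) (pderiv (pderiv \<sigma>))
          + smult (of_nat n + 1 / 2) (pderiv \<kappa>) + [:\<omega>:] = 0)
     \<and>
     ((\<forall>k::nat. 2 \<le> k \<longrightarrow> smult (of_nat k / 2) (pderiv (pderiv \<sigma>)) + pderiv \<kappa> \<noteq> 0) \<longrightarrow>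
        (\<forall>\<omega>. \<exists>B. finite B \<and> card B \<le> 1 \<and> \<not> module.dependent smult B
               \<and> module.span smult B = poly_solutions \<sigma> \<kappa> \<omega>))
     \<and>
     (\<forall>n. \<exists>p :: complex poly. degree p \<le> n
        \<and> (\<forall>z. hyp_op \<sigma> \<kappa> (poly p) z
               - (of_nat n * (of_nat n + 1) * (poly (pderiv (pderiv \<sigma>)) z / 2)
                  + (of_nat n + 1 / 2) * poly (pderiv \<kappa>) z) * poly p z = 0)
        \<and> (\<forall>D \<rho>. weight_on \<sigma> \<kappa> D \<rho> \<longrightarrow>
             (\<forall>z\<in>D. \<rho> z \<noteq> 0 \<and> rodrigues \<sigma> \<rho> n z = poly p z
                \<and> (\<forall>r \<gamma>. 0 < r \<and> ball z r \<subseteq> D \<and> ccw_loop_in (ball 0 r) \<gamma> \<longrightarrow>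
                     rodrigues \<sigma> \<rho> n z =
                       1 / (2 * of_real pi * \<i>) * inverse (\<rho> z) *
                       contour_integral \<gamma>
                         (\<lambda>t. poly \<sigma> (z + t) ^ n * \<rho> (z + t) * t powi (- int n - 1))))))"
proof -
  note s = pderiv2_degree_le_2[OF assms(1)] and k = pderiv_degree_le_1[OF assms(3)]
  show ?thesis
  proof (intro conjI allI impI; (elim conjE)?)
    fix \<omega> n P
    assume "P \<in> poly_solutions \<sigma> \<kappa> \<omega>" "P \<noteq> 0" "degree P = n"
    then show "smult (of_nat n * (of_nat n + 1) / 2) (pderiv (pderiv \<sigma>))
          + smult (of_nat n + 1 / 2) (pderiv \<kappa>) + [:\<omega>:] = 0"
      using poly_solutions_degree[OF assms(1,3), of P \<omega>] by (simp add: s k mult.assoc)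
  next
    fix \<omega>
    assume nz: "\<forall>k::nat. 2 \<le> k \<longrightarrow> smult (of_nat k / 2) (pderiv (pderiv \<sigma>)) + pderiv \<kappa> \<noteq> 0"
    show "\<exists>B. finite B \<and> card B \<le> 1 \<and> \<not> module.dependent smult B
               \<and> module.span smult B = poly_solutions \<sigma> \<kappa> \<omega>"
      using nz by (intro poly_solutions_dim_le_1 assms) (simp add: s k)
  next
    fix n
    \<comment> \<open>The witness is chosen before \<open>D\<close> and \<rho>, so all branches of
      the weight share one polynomial.\<close>
    define p where "p = smult (1 / fact n) (rodrigues_poly \<sigma> \<kappa> n n)"
    have "degree p \<le> n"
      using degree_rodrigues_poly[OF assms(1,3), of n n] by (simp add: p_def)
    moreover have "hyp_op \<sigma> \<kappa> (poly p) z
               - (of_nat n * (of_nat n + 1) * (poly (pderiv (pderiv \<sigma>)) z / 2)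
                  + (of_nat n + 1 / 2) * poly (pderiv \<kappa>) z) * poly p z = 0" for z
    proof -
      have "\<sigma> * pderiv (pderiv p) + (pderiv \<sigma> + \<kappa>) * pderiv p
          = smult (of_nat n * ((of_nat n + 1) * coeff \<sigma> 2 + coeff \<kappa> 1)) p"
        using arg_cong[OF rodrigues_poly_ode[OF s k, of n], of "smult (1 / fact n)"]
        by (simp add: p_def pderiv_smult smult_add_right)
      \<comment> \<open>The zeroth-order term \<kappa>'/2 of the operator turns n\<kappa>' into (n +
        1/2)\<kappa>'.\<close>
      then show ?thesis
        by (simp only: hyp_op_poly) (simp add: s k algebra_simps)
    qed
    moreover have "\<rho> z \<noteq> 0 \<and> rodrigues \<sigma> \<rho> n z = poly p z" if "weight_on \<sigma> \<kappa> D \<rho>" "z \<in> D" for D \<rho> z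
      using weight_nonzero[OF that] rodrigues_eq_poly[OF that] by (simp only: p_def) simp
    ultimately show "\<exists>p :: complex poly. degree p \<le> n
        \<and> (\<forall>z. hyp_op \<sigma> \<kappa> (poly p) z
               - (of_nat n * (of_nat n + 1) * (poly (pderiv (pderiv \<sigma>)) z / 2)
                  + (of_nat n + 1 / 2) * poly (pderiv \<kappa>) z) * poly p z = 0)
        \<and> (\<forall>D \<rho>. weight_on \<sigma> \<kappa> D \<rho> \<longrightarrow>
             (\<forall>z\<in>D. \<rho> z \<noteq> 0 \<and> rodrigues \<sigma> \<rho> n z = poly p z
                \<and> (\<forall>r \<gamma>. 0 < r \<and> ball z r \<subseteq> D \<and> ccw_loop_in (ball 0 r) \<gamma> \<longrightarrow>
                     rodrigues \<sigma> \<rho> n z =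
                       1 / (2 * of_real pi * \<i>) * inverse (\<rho> z) *
                       contour_integral \<gamma>
                         (\<lambda>t. poly \<sigma> (z + t) ^ n * \<rho> (z + t) * t powi (- int n - 1)))))"
      by (intro exI[of _ p] conjI allI impI ballI) (blast intro: rodrigues_contour)+
  qed
qed

end
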